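(* Let $\mathcal{C}_1,\dots,\mathcal{C}_N$ be disjoint clusters of devices, with lead device $k_n\in\mathcal{C}_n$, and let $\tilde k_n$ denote a generic subordinate device of cluster $n$, i.e. $\tilde k_n\in\mathcal{C}_n\setminus\{k_n\}$; all sums over $\tilde k_n\in\mathcal{C}_n$ below are over subordinate devices. Let $c_1>0$, $\zeta>0$, $\beta_{k_n}>0$, channel magnitudes $\bar h_{k_n}>0$, $\bar h_{\tilde k_n,k_n}>0$, noise variances $\sigma_{k_n}^2$, and power budgets $P_{\tilde k_n}^{\max}$, $P_{k_n}^{\max}$ be given, and put $\bar P_{k_n}^{\max}=P_{k_n}^{\max}/\beta_{k_n}$. Consider the problem over the transmit powers $\alpha_{\tilde k_n}\ge 0$: $$\min_{\{\alpha_{\tilde k_n}\}}\ c_1\sum_{n=1}^N\sum_{\tilde k_n\in\mathcal{C}_n}\left(\zeta\bar h_{k_n}\sqrt{\beta_{k_n}}\,\bar h_{\tilde k_n,k_n}\sqrt{\alpha_{\tilde k_n}}-1\right)^2$$ subject to $$\alpha_{\tilde k_n}\le P_{\tilde k_n}^{\max}\ \ \text{for all } \tilde k_n\in\mathcal{C}_n \text{ and all } n,\qquad \sum_{\tilde k_n\in\mathcal{C}_n}\bar h_{\tilde k_n,k_n}^2\alpha_{\tilde k_n}+\sigma_{k_n}^2\le \frac{P_{k_n}^{\max}}{\beta_{k_n}}\ \ \text{for all } n.$$ Then the optimal solution is $$\alpha_{\tilde k_n}^{\rm opt}=\min\left[\left(\frac{c_1\zeta\bar h_{k_n}\sqrt{\beta_{k_n}}\,\bar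 h_{\tilde k_n,k_n}}{c_1\zeta^2\bar h_{k_n}^2\beta_{k_n}\bar h_{\tilde k_n,k_n}^2+\mu_n^{\rm opt}\bar h_{\tilde k_n,k_n}^2}\right)^2,\ P_{\tilde k_n}^{\max}\right],\qquad \tilde k_n\in\mathcal{C}_n,\ \forall n,$$ where the $\mu_n^{\rm opt}$ are non-negative and satisfy the complementary slackness conditions $$\mu_n^{\rm opt}\left(\sum_{\tilde k_n\in\mathcal{C}_n}\bar h_{\tilde k_n,k_n}^2\alpha_{\tilde k_n}^{\rm opt}+\sigma_{k_n}^2-\bar P_{k_n}^{\max}\right)=0,\qquad \forall n.$$
   Context: The problem arises in a two-tier over-the-air federated learning system with $K$ devices $\mathcal{K}$ partitioned into $N$ clusters: subordinate device $\tilde k_n$ transmits to its lead device $k_n$ with power $\alpha_{\tilde k_n}$ over a channel of magnitude $\bar h_{\tilde k_n,k_n}$; lead device $k_n$ (receiver noise variance $\sigma_{k_n}^2$) forwards to the parameter server with power coefficient $\beta_{k_n}$ over a channel of magnitude $\bar h_{k_n}$; $\zeta$ is the de-noising factor at the server. $P_k^{\max}$ is the maximum power budget of device $k$. In the paper $c_1=\frac{(A+B)\sum_{k\in\mathcal{K}}\|\Delta\mathbf{g}_k\|_2^2}{K^2}$, where $\Delta\mathbf{g}_k$ are centred local gradient vectors and $A,B>0$ are constants; all that matters here is that $c_1$ does not depend on the optimization variables. "Optimal solution" means a feasible minimizer of the stated problem.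
   Formalization: Added: the problem has a feasible point, and the noise variance is strictly below P_lead/β in every cluster having a subordinate with positive budget; with equality there the only feasible powers are 0 while the stated formula is positive, so the claim fails. *)

theory Defs
  imports Complex_Main "HOL-Library.Disjoint_Sets"
begin

text \<open>
  Clusters are indexed by \<open>1..N\<close>; \<open>C n\<close> is the set of devices of cluster \<open>n\<close> and \<open>l n\<close> its lead
  device.  Per-device data are functions on devices: \<open>h k\<close> is the channel magnitude from device
  \<open>k\<close> to the server, \<open>g k j\<close> the channel magnitude from device \<open>k\<close> to device \<open>j\<close>, \<open>\<beta>\<close> the power
  coefficient, \<open>\<sigma>\<close> the noise standard deviation (variance \<open>(\<sigma> k)\<^sup>2\<close>), \<open>P\<close> the maximum power, and
  \<open>\<alpha>\<close> the transmit power.  Only the values of \<open>\<alpha>\<close> on subordinate devices are decision variables;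
  its other values are irrelevant to the problem.
\<close>

definition subordinates :: "(nat \<Rightarrow> 'd set) \<Rightarrow> (nat \<Rightarrow> 'd) \<Rightarrow> nat \<Rightarrow> 'd set" where
  "subordinates C l n = C n - {l n}"

definition objective ::
  "nat \<Rightarrow> (nat \<Rightarrow> 'd set) \<Rightarrow> (nat \<Rightarrow> 'd) \<Rightarrow> real \<Rightarrow> real \<Rightarrow> ('d \<Rightarrow> real) \<Rightarrow> ('d \<Rightarrow> 'd \<Rightarrow> real)
    \<Rightarrow> ('d \<Rightarrow> real) \<Rightarrow> ('d \<Rightarrow> real) \<Rightarrow> real" where
  "objective N C l c1 \<zeta> h g \<beta> \<alpha> =
     c1 * (\<Sum>n=1..N. \<Sum>k\<in>subordinates C l n.
             (\<zeta> * h (l n) * sqrt (\<beta> (l n)) * g k (l n) * sqrt (\<alpha> k) - 1)\<^sup>2)"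

definition lead_load ::
  "(nat \<Rightarrow> 'd set) \<Rightarrow> (nat \<Rightarrow> 'd) \<Rightarrow> ('d \<Rightarrow> 'd \<Rightarrow> real) \<Rightarrow> ('d \<Rightarrow> real) \<Rightarrow> ('d \<Rightarrow> real) \<Rightarrow> nat \<Rightarrow> real" where
  "lead_load C l g \<sigma> \<alpha> n = (\<Sum>k\<in>subordinates C l n. (g k (l n))\<^sup>2 * \<alpha> k) + (\<sigma> (l n))\<^sup>2"

definition feasible ::
  "nat \<Rightarrow> (nat \<Rightarrow> 'd set) \<Rightarrow> (nat \<Rightarrow> 'd) \<Rightarrow> ('d \<Rightarrow> 'd \<Rightarrow> real) \<Rightarrow> ('d \<Rightarrow> real) \<Rightarrow> ('d \<Rightarrow> real)
    \<Rightarrow> ('d \<Rightarrow> real) \<Rightarrow> ('d \<Rightarrow> real) \<Rightarrow> bool" where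
  "feasible N C l g \<beta> \<sigma> P \<alpha> \<longleftrightarrow>
     (\<forall>n\<in>{1..N}. (\<forall>k\<in>subordinates C l n. 0 \<le> \<alpha> k \<and> \<alpha> k \<le> P k)
        \<and> lead_load C l g \<sigma> \<alpha> n \<le> P (l n) / \<beta> (l n))"

end

theory Submission
  imports Defs
begin

text \<open>
  Dualize only the load constraints. For a multiplier \<open>\<mu> \<ge> 0\<close> the Lagrangian separates over devices and
  is, in the variable \<open>sqrt \<alpha>\<close>, a strictly convex quadratic on an interval whose minimizer is the
  stated truncated expression; the quadratic growth around that minimizer together with
  complementary slackness yields optimality and uniqueness at once. The load is continuous in
  \<open>\<mu>\<close> and tends to the noise variance, so either \<open>\<mu> = 0\<close> works or the intermediate value theorem
  provides a multiplier at which the load constraint is tight.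
\<close>

text \<open>For \<open>c, a > 0\<close> and \<open>m, p \<ge> 0\<close> this is the minimizer of
  \<open>c * (a * sqrt x - 1)\<^sup>2 + m * x\<close> over \<open>0 \<le> x \<le> p\<close>. Below,
  \<open>m\<close> is the multiplier times the squared channel gain.\<close>

definition threshold_power :: "real \<Rightarrow> real \<Rightarrow> real \<Rightarrow> real \<Rightarrow> real" where
  "threshold_power c a m p = min ((c * a / (c * a\<^sup>2 + m))\<^sup>2) p"

lemma threshold_power_nonneg: "0 \<le> p \<Longrightarrow> 0 \<le> threshold_power c a m p"
  by (simp add: threshold_power_def)

lemma threshold_power_le: "threshold_power c a m p \<le> p"
  by (simp add: threshold_power_def)

text \<open>In the variable \<open>sqrt x\<close> the penalized cost is a quadratic with leading
  coefficient \<open>c * a\<^sup>2 + m\<close>, and \<open>sqrt y\<close> is its vertex clipped to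
  the interval. Expanding at a constrained minimizer leaves the square term plus a first-order term
  that is nonnegative on the interval.\<close>

lemma penalized_square_growth:
  fixes c a m p x :: real
  assumes c: "c > 0" and a: "a > 0" and m: "m \<ge> 0" and x: "0 \<le> x" "x \<le> p"
  defines "y \<equiv> threshold_power c a m p"
  shows "c * (a * sqrt y - 1)\<^sup>2 + m * y + (c * a\<^sup>2 + m) * (sqrt x - sqrt y)\<^sup>2
           \<le> c * (a * sqrt x - 1)\<^sup>2 + m * x"
proof -
  define D where "D = c * a\<^sup>2 + m"
  define u where "u = c * a / D"
  have D: "D > 0" using c a m unfolding D_def by (simp add: add_pos_nonneg)
  have u: "u \<ge> 0" using c a D by (simp add: u_def)
  have y: "y = min (u\<^sup>2) p" by (simp add: y_def threshold_power_def u_def D_def)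
  have y0: "y \<ge> 0" using x y by simp
  \<comment> \<open>First-order optimality: \<open>2 * (D * sqrt y - c * a)\<close> is the
    derivative of the quadratic at \<open>sqrt y\<close>. It vanishes if the vertex \<open>u\<close>
    lies in the interval; if the cap \<open>p\<close> is active, both factors are
    nonpositive.\<close>
  have "0 \<le> (sqrt x - sqrt y) * (D * sqrt y - c * a)"
  proof (cases "u\<^sup>2 \<le> p")
    case True
    then have "sqrt y = u" using y u by simp
    then show ?thesis using D by (simp add: u_def)
  next
    case False
    then have "y = p" using y by simp
    then have 1: "sqrt x \<le> sqrt y" using x by simp
    have "sqrt y \<le> u" using y u by (intro real_le_lsqrt) auto
    then have "D * sqrt y \<le> c * a" using D by (simp add: u_def field_simps)
    with 1 show ?thesis by (simp add: mult_nonpos_nonpos)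
  qed
  \<comment> \<open>The second-order Taylor expansion at \<open>sqrt y\<close>, exact for a
    quadratic; its linear term is twice the product bounded above.\<close>
  moreover have "c * (a * sqrt x - 1)\<^sup>2 + m * (sqrt x)\<^sup>2
      = c * (a * sqrt y - 1)\<^sup>2 + m * (sqrt y)\<^sup>2 + D * (sqrt x - sqrt y)\<^sup>2
        + 2 * ((sqrt x - sqrt y) * (D * sqrt y - c * a))"
    unfolding D_def by (simp only: power2_eq_square) algebra
  ultimately show ?thesis using x y0 by (simp add: D_def)
qed

text \<open>If the load at \<open>\<mu> = 0\<close> exceeds \<open>t\<close>, it falls continuously
  towards \<open>s\<close> as \<open>\<mu>\<close> grows, so it crosses \<open>t\<close> once
  \<open>s < t\<close>. If \<open>s = t\<close>, a positive budget would keep the load above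
  \<open>t\<close> for every finite \<open>\<mu>\<close>; assumption \<open>less\<close> excludes
  this.\<close>

lemma complementary_multiplier_exists:
  fixes a w p :: "'d \<Rightarrow> real" and c s t :: real
  assumes c: "c > 0"
    and a: "\<And>k. k \<in> S \<Longrightarrow> a k > 0"
    and w: "\<And>k. k \<in> S \<Longrightarrow> w k > 0"
    and p: "\<And>k. k \<in> S \<Longrightarrow> p k \<ge> 0"
    and le: "s \<le> t"
    and less: "\<And>k. k \<in> S \<Longrightarrow> p k > 0 \<Longrightarrow> s < t"
  shows "\<exists>\<mu>\<ge>0. (\<Sum>k\<in>S. w k * threshold_power c (a k) (\<mu> * w k) (p k)) + s \<le> t
      \<and> \<mu> * ((\<Sum>k\<in>S. w k * threshold_power c (a k) (\<mu> * w k) (p k)) + s - t) = 0"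
proof -
  define L where "L = (\<lambda>\<mu>. (\<Sum>k\<in>S. w k * threshold_power c (a k) (\<mu> * w k) (p k)) + s)"
  have "\<exists>\<mu>\<ge>0. L \<mu> \<le> t \<and> \<mu> * (L \<mu> - t) = 0"
  proof (cases "L 0 \<le> t")
    case True
    then show ?thesis by auto
  next
    case False
    \<comment> \<open>Otherwise \<open>less\<close> forces all budgets to be zero, so that already
      \<open>L 0 = s \<le> t\<close>.\<close>
    have "s < t"
    proof (rule ccontr)
      assume "\<not> s < t"
      then have "p k = 0" if "k \<in> S" for k
        using less[OF that] p[OF that] by force
      then have "L 0 = s" by (simp add: L_def threshold_power_def)
      with le False show False by simp
    qed
    \<comment> \<open>The denominator grows linearly in \<open>\<mu>\<close>, so the untruncated
      power tends to 0, and the cap \<open>p k \<ge> 0\<close> does not alter this limit.\<close>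
    have "((\<lambda>\<mu>. w k * threshold_power c (a k) (\<mu> * w k) (p k)) \<longlongrightarrow> 0) at_top"
      if k: "k \<in> S" for k
    proof -
      have "filterlim (\<lambda>\<mu>. c * (a k)\<^sup>2 + \<mu> * w k) at_top at_top"
        using w[OF k]
        by (intro filterlim_tendsto_add_at_top[OF tendsto_const]
            filterlim_at_top_mult_tendsto_pos[OF tendsto_const] filterlim_ident)
      then have "((\<lambda>\<mu>. c * a k / (c * (a k)\<^sup>2 + \<mu> * w k)) \<longlongrightarrow> 0) at_top"
        by (intro tendsto_divide_0[OF tendsto_const] filterlim_at_top_imp_at_infinity)
      then have "((\<lambda>\<mu>. w k * min ((c * a k / (c * (a k)\<^sup>2 + \<mu> * w k))\<^sup>2) (p k))
          \<longlongrightarrow> w k * min (0\<^sup>2) (p k)) at_top"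
        by (intro tendsto_intros)
      then show ?thesis using p[OF k] by (simp add: threshold_power_def)
    qed
    then have "(L \<longlongrightarrow> (\<Sum>k\<in>S. 0) + s) at_top"
      unfolding L_def by (intro tendsto_intros)
    then have "eventually (\<lambda>\<mu>. L \<mu> < t) at_top"
      using \<open>s < t\<close> by (intro order_tendstoD(2)) auto
    then obtain K where K: "\<And>\<mu>. \<mu> \<ge> K \<Longrightarrow> L \<mu> < t"
      unfolding eventually_at_top_linorder by blast
    define M where "M = max 0 K"
    have M: "M \<ge> 0" "L M < t" using K[of M] by (simp_all add: M_def)
    \<comment> \<open>Continuity of \<open>L\<close> on \<open>{0..M}\<close> needs nonvanishing
      denominators, which \<open>\<mu> \<ge> 0\<close> ensures.\<close>
    have "c * (a k)\<^sup>2 + \<mu> * w k \<noteq> 0" if "k \<in> S" "\<mu> \<ge> 0" for k \<mu>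
      using c a[OF that(1)] w[OF that(1)] that(2)
      by (intro less_imp_neq[THEN not_sym] add_pos_nonneg) auto
    then have "continuous_on {0..M} L"
      unfolding L_def threshold_power_def by (intro continuous_intros) auto
    then obtain \<mu> where "0 \<le> \<mu>" "L \<mu> = t"
      using IVT2'[of L M t 0] M False by auto
    then show ?thesis by auto
  qed
  then show ?thesis by (simp add: L_def)
qed

text \<open>The hypothesis \<open>strict\<close> is a Slater-type condition: if the noise alone
  exhausted a lead's budget, feasibility would force its subordinates to power 0, whereas the
  formula is positive for every finite multiplier when \<open>P k > 0\<close>.\<close>

theorem proposition1:
  fixes N :: nat and C :: "nat \<Rightarrow> 'd set" and l :: "nat \<Rightarrow> 'd"
    and c1 \<zeta> :: real and h \<beta> \<sigma> P :: "'d \<Rightarrow> real" and g :: "'d \<Rightarrow> 'd \<Rightarrow> real"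
  assumes "disjoint_family_on C {1..N}"
    and "\<And>n. n \<in> {1..N} \<Longrightarrow> finite (C n)"
    and "\<And>n. n \<in> {1..N} \<Longrightarrow> l n \<in> C n"
    and "c1 > 0" and "\<zeta> > 0"
    and "\<And>n. n \<in> {1..N} \<Longrightarrow> \<beta> (l n) > 0"
    and "\<And>n. n \<in> {1..N} \<Longrightarrow> h (l n) > 0"
    and "\<And>n k. n \<in> {1..N} \<Longrightarrow> k \<in> subordinates C l n \<Longrightarrow> g k (l n) > 0"
    and feasible: "\<exists>\<alpha>. feasible N C l g \<beta> \<sigma> P \<alpha>"
    and strict: "\<And>n k. n \<in> {1..N} \<Longrightarrow> k \<in> subordinates C l n \<Longrightarrow> P k > 0
                   \<Longrightarrow> (\<sigma> (l n))\<^sup>2 < P (l n) / \<beta> (l n)"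
  shows "\<exists>\<alpha>opt \<mu>opt.
      is_arg_min (objective N C l c1 \<zeta> h g \<beta>) (feasible N C l g \<beta> \<sigma> P) \<alpha>opt
    \<and> (\<forall>\<alpha>. is_arg_min (objective N C l c1 \<zeta> h g \<beta>) (feasible N C l g \<beta> \<sigma> P) \<alpha>
           \<longrightarrow> (\<forall>n\<in>{1..N}. \<forall>k\<in>subordinates C l n. \<alpha> k = \<alpha>opt k))
    \<and> (\<forall>n\<in>{1..N}. \<forall>k\<in>subordinates C l n.
          \<alpha>opt k = min ((c1 * \<zeta> * h (l n) * sqrt (\<beta> (l n)) * g k (l n)
                         / (c1 * \<zeta>\<^sup>2 * (h (l n))\<^sup>2 * \<beta> (l n) * (g k (l n))\<^sup>2
                            + \<mu>opt n * (g k (l n))\<^sup>2))\<^sup>2)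
                       (P k))
    \<and> (\<forall>n\<in>{1..N}. (\<mu>opt n :: real) \<ge> 0
          \<and> \<mu>opt n * (lead_load C l g \<sigma> \<alpha>opt n - P (l n) / \<beta> (l n)) = 0)"
proof -
  define S where "S = subordinates C l"
  define a where "a = (\<lambda>n k. \<zeta> * h (l n) * sqrt (\<beta> (l n)) * g k (l n))"
  define w where "w = (\<lambda>n k. (g k (l n))\<^sup>2)"
  define T where "T = (\<lambda>n. P (l n) / \<beta> (l n))"
  have finS: "finite (S n)" if "n \<in> {1..N}" for n
    using assms(2)[OF that] by (simp add: S_def subordinates_def)
  have g: "g k (l n) > 0" if "n \<in> {1..N}" "k \<in> S n" for n k
    using assms(8) that by (simp add: S_def)
  have a: "a n k > 0" and w: "w n k > 0" if "n \<in> {1..N}" "k \<in> S n" for n k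
    using assms(5) assms(6,7)[OF that(1)] g[OF that]
    by (simp_all add: a_def w_def)
  have load: "lead_load C l g \<sigma> \<alpha> n = (\<Sum>k\<in>S n. w n k * \<alpha> k) + (\<sigma> (l n))\<^sup>2" for \<alpha> n
    by (simp add: lead_load_def S_def w_def)
  have feas: "feasible N C l g \<beta> \<sigma> P \<alpha> \<longleftrightarrow> (\<forall>n\<in>{1..N}. (\<forall>k\<in>S n. 0 \<le> \<alpha> k \<and> \<alpha> k \<le> P k)
      \<and> lead_load C l g \<sigma> \<alpha> n \<le> T n)" for \<alpha>
    by (simp add: feasible_def S_def T_def)
  define obj where "obj = objective N C l c1 \<zeta> h g \<beta>"
  have obj: "obj \<alpha> = (\<Sum>n=1..N. \<Sum>k\<in>S n. c1 * (a n k * sqrt (\<alpha> k) - 1)\<^sup>2)" for \<alpha>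
    by (simp add: obj_def objective_def S_def a_def sum_distrib_left)
  \<comment> \<open>Any feasible point certifies that the budgets are nonnegative and that the noise
    alone fits the load bound.\<close>
  obtain \<alpha>0 where \<alpha>0: "feasible N C l g \<beta> \<sigma> P \<alpha>0" using feasible by blast
  have P: "P k \<ge> 0" if "n \<in> {1..N}" "k \<in> S n" for n k
    using \<alpha>0 that unfolding feas by force
  have noise: "(\<sigma> (l n))\<^sup>2 \<le> T n" if n: "n \<in> {1..N}" for n
  proof -
    have "0 \<le> (\<Sum>k\<in>S n. w n k * \<alpha>0 k)"
      using \<alpha>0 n w[OF n] unfolding feas by (force intro!: sum_nonneg mult_nonneg_nonneg)
    moreover have "(\<Sum>k\<in>S n. w n k * \<alpha>0 k) + (\<sigma> (l n))\<^sup>2 \<le> T n"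
      using \<alpha>0 n unfolding feas load by blast
    ultimately show ?thesis by linarith
  qed
  define threshold_load where
    "threshold_load = (\<lambda>n \<mu>. (\<Sum>k\<in>S n. w n k * threshold_power c1 (a n k) (\<mu> * w n k) (P k)) + (\<sigma> (l n))\<^sup>2)"
  have "\<exists>\<mu>\<ge>0. threshold_load n \<mu> \<le> T n \<and> \<mu> * (threshold_load n \<mu> - T n) = 0" if n: "n \<in> {1..N}" for n
    using complementary_multiplier_exists[of c1 "S n" "a n" "w n" P "(\<sigma> (l n))\<^sup>2" "T n"]
      \<open>c1 > 0\<close> a[OF n] w[OF n] P[OF n] noise[OF n] strict[OF n]
    by (simp add: S_def T_def threshold_load_def)
  then obtain \<mu> where \<mu>: "\<And>n. n \<in> {1..N} \<Longrightarrow> \<mu> n \<ge> 0"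
    and \<mu>_le: "\<And>n. n \<in> {1..N} \<Longrightarrow> threshold_load n (\<mu> n) \<le> T n"
    and \<mu>_slack: "\<And>n. n \<in> {1..N} \<Longrightarrow> \<mu> n * (threshold_load n (\<mu> n) - T n) = 0"
    by metis
  \<comment> \<open>Powers are indexed by devices alone, while the formula also depends on the
    cluster. Disjointness makes the cluster of a subordinate device unique, so the choice is well
    defined.\<close>
  define cl where "cl = (\<lambda>k. SOME n. n \<in> {1..N} \<and> k \<in> S n)"
  have cl: "cl k = n" if "n \<in> {1..N}" "k \<in> S n" for n k
  proof -
    have "cl k \<in> {1..N} \<and> k \<in> S (cl k)"
      unfolding cl_def by (rule someI[of _ n]) (use that in blast)
    then show ?thesis
      using that disjoint_family_onD[OF assms(1), of "cl k" n]
      by (auto simp: S_def subordinates_def)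
  qed
  define \<alpha>opt where "\<alpha>opt = (\<lambda>k. threshold_power c1 (a (cl k) k) (\<mu> (cl k) * w (cl k) k) (P k))"
  have \<alpha>opt: "\<alpha>opt k = threshold_power c1 (a n k) (\<mu> n * w n k) (P k)"
    if "n \<in> {1..N}" "k \<in> S n" for n k
    using cl[OF that] by (simp add: \<alpha>opt_def)
  have load_opt: "lead_load C l g \<sigma> \<alpha>opt n = threshold_load n (\<mu> n)" if "n \<in> {1..N}" for n
    using \<alpha>opt[OF that] by (simp add: load threshold_load_def)
  have feas_opt: "feasible N C l g \<beta> \<sigma> P \<alpha>opt"
    unfolding feas using \<mu>_le P by (simp add: load_opt \<alpha>opt threshold_power_nonneg threshold_power_le)
  have slack: "\<mu> n * (lead_load C l g \<sigma> \<alpha>opt n - T n) = 0" if "n \<in> {1..N}" for n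
    using \<mu>_slack[OF that] by (simp add: load_opt[OF that])
  \<comment> \<open>The quadratic growth term of \<open>penalized_square_growth\<close>. Its weight
    is positive, so a zero gap identifies \<open>\<alpha> k\<close> with
    \<open>\<alpha>opt k\<close>.\<close>
  define gap where "gap = (\<lambda>\<alpha> n k. (c1 * (a n k)\<^sup>2 + \<mu> n * w n k) * (sqrt (\<alpha> k) - sqrt (\<alpha>opt k))\<^sup>2)"
  have weight: "c1 * (a n k)\<^sup>2 + \<mu> n * w n k > 0" if "n \<in> {1..N}" "k \<in> S n" for n k
    using \<open>c1 > 0\<close> a[OF that] w[OF that] \<mu>[OF that(1)] by (simp add: add_pos_nonneg)
  have gap_nonneg: "gap \<alpha> n k \<ge> 0" if "n \<in> {1..N}" "k \<in> S n" for \<alpha> n k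
    using weight[OF that] by (simp add: gap_def)
  have growth: "obj \<alpha>opt + (\<Sum>n=1..N. \<Sum>k\<in>S n. gap \<alpha> n k) \<le> obj \<alpha>"
    if \<alpha>: "feasible N C l g \<beta> \<sigma> P \<alpha>" for \<alpha>
  proof -
    have "(\<Sum>k\<in>S n. c1 * (a n k * sqrt (\<alpha>opt k) - 1)\<^sup>2) + (\<Sum>k\<in>S n. gap \<alpha> n k)
        \<le> (\<Sum>k\<in>S n. c1 * (a n k * sqrt (\<alpha> k) - 1)\<^sup>2)" if n: "n \<in> {1..N}" for n
    proof -
      have "(\<Sum>k\<in>S n. c1 * (a n k * sqrt (\<alpha>opt k) - 1)\<^sup>2 + \<mu> n * w n k * \<alpha>opt k + gap \<alpha> n k)
          \<le> (\<Sum>k\<in>S n. c1 * (a n k * sqrt (\<alpha> k) - 1)\<^sup>2 + \<mu> n * w n k * \<alpha> k)"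
      proof (rule sum_mono)
        fix k assume k: "k \<in> S n"
        show "c1 * (a n k * sqrt (\<alpha>opt k) - 1)\<^sup>2 + \<mu> n * w n k * \<alpha>opt k + gap \<alpha> n k
            \<le> c1 * (a n k * sqrt (\<alpha> k) - 1)\<^sup>2 + \<mu> n * w n k * \<alpha> k"
          unfolding gap_def \<alpha>opt[OF n k]
          using \<alpha> n k \<open>c1 > 0\<close> a[OF n k] w[OF n k] \<mu>[OF n] unfolding feas
          by (intro penalized_square_growth) auto
      qed
      then have "(\<Sum>k\<in>S n. c1 * (a n k * sqrt (\<alpha>opt k) - 1)\<^sup>2)
            + \<mu> n * (\<Sum>k\<in>S n. w n k * \<alpha>opt k) + (\<Sum>k\<in>S n. gap \<alpha> n k)
          \<le> (\<Sum>k\<in>S n. c1 * (a n k * sqrt (\<alpha> k) - 1)\<^sup>2) + \<mu> n * (\<Sum>k\<in>S n. w n k * \<alpha> k)"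
        by (simp add: sum.distrib sum_distrib_left mult.assoc)
      moreover have "\<mu> n * (\<Sum>k\<in>S n. w n k * \<alpha> k) \<le> \<mu> n * (\<Sum>k\<in>S n. w n k * \<alpha>opt k)"
      proof -
        have "\<mu> n * lead_load C l g \<sigma> \<alpha> n \<le> \<mu> n * T n"
          using \<alpha> n \<mu>[OF n] unfolding feas by (simp add: mult_left_mono)
        also have "\<dots> = \<mu> n * lead_load C l g \<sigma> \<alpha>opt n"
          using slack[OF n] by auto
        finally show ?thesis by (simp add: load distrib_left)
      qed
      ultimately show ?thesis by linarith
    qed
    then have "(\<Sum>n=1..N. (\<Sum>k\<in>S n. c1 * (a n k * sqrt (\<alpha>opt k) - 1)\<^sup>2) + (\<Sum>k\<in>S n. gap \<alpha> n k))
        \<le> (\<Sum>n=1..N. \<Sum>k\<in>S n. c1 * (a n k * sqrt (\<alpha> k) - 1)\<^sup>2)"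
      by (rule sum_mono)
    then show ?thesis by (simp only: obj sum.distrib)
  qed
  have opt: "is_arg_min obj (feasible N C l g \<beta> \<sigma> P) \<alpha>opt"
    unfolding is_arg_min_linorder
  proof (intro conjI allI impI feas_opt)
    fix \<alpha> assume "feasible N C l g \<beta> \<sigma> P \<alpha>"
    moreover have "0 \<le> (\<Sum>n=1..N. \<Sum>k\<in>S n. gap \<alpha> n k)"
      by (intro sum_nonneg gap_nonneg)
    ultimately show "obj \<alpha>opt \<le> obj \<alpha>" using growth by force
  qed
  have unique: "\<alpha> k = \<alpha>opt k"
    if min: "is_arg_min obj (feasible N C l g \<beta> \<sigma> P) \<alpha>" and n: "n \<in> {1..N}" and k: "k \<in> S n" for \<alpha> n k
  proof -
    have "feasible N C l g \<beta> \<sigma> P \<alpha>" "obj \<alpha> \<le> obj \<alpha>opt"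
      using min feas_opt by (auto simp: is_arg_min_linorder)
    \<comment> \<open>A second minimizer leaves no room for growth: the total gap is zero, hence so
      is each of its nonnegative terms.\<close>
    then have "(\<Sum>n=1..N. \<Sum>k\<in>S n. gap \<alpha> n k) \<le> 0" using growth by force
    then have "(\<Sum>n=1..N. \<Sum>k\<in>S n. gap \<alpha> n k) = 0"
      by (intro antisym sum_nonneg gap_nonneg)
    then have "(\<Sum>k\<in>S n. gap \<alpha> n k) = 0"
      using n by (subst (asm) sum_nonneg_eq_0_iff) (auto intro!: sum_nonneg gap_nonneg)
    then have "gap \<alpha> n k = 0"
      using k n finS[OF n] by (subst (asm) sum_nonneg_eq_0_iff) (auto intro!: gap_nonneg)
    \<comment> \<open>The positive weight leaves equal square roots, and \<open>sqrt\<close> is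
      injective on all reals.\<close>
    then show ?thesis using weight[OF n k] by (simp add: gap_def)
  qed
  have formula: "\<alpha>opt k = min ((c1 * \<zeta> * h (l n) * sqrt (\<beta> (l n)) * g k (l n)
        / (c1 * \<zeta>\<^sup>2 * (h (l n))\<^sup>2 * \<beta> (l n) * (g k (l n))\<^sup>2 + \<mu> n * (g k (l n))\<^sup>2))\<^sup>2) (P k)"
    if "n \<in> {1..N}" "k \<in> S n" for n k
    \<comment> \<open>Positivity of \<open>\<beta> (l n)\<close> turns the square of
      \<open>sqrt (\<beta> (l n))\<close> in the denominator into
      \<open>\<beta> (l n)\<close>.\<close>
    using assms(6)[OF that(1)]
    by (simp add: \<alpha>opt[OF that] threshold_power_def a_def w_def power_mult_distrib mult.assoc)
  show ?thesis
  proof (intro exI conjI ballI allI impI)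
    show "is_arg_min (objective N C l c1 \<zeta> h g \<beta>) (feasible N C l g \<beta> \<sigma> P) \<alpha>opt"
      using opt by (simp only: obj_def)
  qed (fact unique[unfolded obj_def S_def] formula[unfolded S_def] \<mu> slack[unfolded T_def])+
qed

end
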